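(* Let $m\ge 0$ be an integer and let $A(g)$ and $B(g)$ be two quadrature rules on $[-1,1]$ of degree $m$. Then the mean rule $W(g)$ of $A(g)$ and $B(g)$ has degree at least $m+1$, i.e. $W(\phi_j)=\int_{-1}^1 t^j\,dt$ for all $0\le j\le m+1$.
   Context: For a function $g$ on $[-1,1]$ put $I(g)=\int_{-1}^1 g(t)\,dt$. A quadrature rule $Q$ assigns to each (sufficiently smooth) function $g$ on $[-1,1]$ a real number $Q(g)$, an approximation of $I(g)$ computed from values of $g$ (and/or its derivatives) on a discrete set of points in $[-1,1]$. Monomials are denoted $\phi_j(t)=t^j$, $j=0,1,\ldots$. A rule $Q$ is of degree $m\ge 0$ if $Q(\phi_j)=I(\phi_j)$ for all $0\le j\le m$ but $Q(\phi_{m+1})\neq I(\phi_{m+1})$. Mean rule: for rules $A,B$ of degree $m$ put $\mu=\int_{-1}^1 t^{m+1}\,dt$, $\mu_A=A(\phi_{m+1})$, $\mu_B=B(\phi_{m+1})$. The mean rule of $A$ and $B$ is $$W(g)=\begin{cases}\dfrac{A(g)+B(g)}{2}, & \text{if } \mu_A=\mu_B,\\[2mm] \dfrac{\mu_B-\mu}{\mu_B-\mu_A}\,A(g)+\dfrac{\mu-\mu_A}{\mu_B-\mu_A}\,B(g), & \text{if } \mu_A\neq\mu_B.\end{cases}$$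
   Formalization: Exactness of W at φ_{m+1} is claimed only when μ_A ≠ μ_B; if μ_A = μ_B then W(φ_{m+1}) = μ_A ≠ μ (e.g. m = 0, A(g) = B(g) = 2g(1/2)), so there only exactness for 0 ≤ j ≤ m is stated. *)

theory Defs
  imports "HOL-Analysis.Analysis"
begin

definition I :: "(real \<Rightarrow> real) \<Rightarrow> real" where
  "I g = integral {-1..1} g"

definition \<phi> :: "nat \<Rightarrow> real \<Rightarrow> real" where
  "\<phi> j = (\<lambda>t. t ^ j)"

(* Derivatives are taken within [-1,1] (one-sided at the end points), so on [-1,1]
   they do not depend on the values of the total function g outside the interval. *)
definition D :: "nat \<Rightarrow> (real \<Rightarrow> real) \<Rightarrow> real \<Rightarrow> real" where
  "D k g = ((\<lambda>f t. vector_derivative f (at t within {-1..1})) ^^ k) g"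

definition smooth_upto :: "nat \<Rightarrow> (real \<Rightarrow> real) \<Rightarrow> bool" where
  "smooth_upto r g \<longleftrightarrow>
     (\<forall>k<r. D k g differentiable_on {-1..1}) \<and> continuous_on {-1..1} (D r g)"

(* A rule is a functional whose value on r times continuously differentiable functions
   is determined by the values and the first r derivatives at a discrete set X of points
   of [-1,1].  Neither linearity nor a particular shape of the formula is imposed; weighted
   sums of values and derivatives at finitely many nodes are an instance. *)
definition quadrature_rule :: "((real \<Rightarrow> real) \<Rightarrow> real) \<Rightarrow> bool" where
  "quadrature_rule Q \<longleftrightarrow>
     (\<exists>r X. X \<subseteq> {-1..1} \<and> discrete X \<and>
        (\<forall>g h. smooth_upto r g \<and> smooth_upto r h \<and> (\<forall>x\<in>X. \<forall>k\<le>r. D k g x = D k h x)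
                \<longrightarrow> Q g = Q h))"

definition degree_at_least :: "((real \<Rightarrow> real) \<Rightarrow> real) \<Rightarrow> nat \<Rightarrow> bool" where
  "degree_at_least Q m \<longleftrightarrow> (\<forall>j\<le>m. Q (\<phi> j) = I (\<phi> j))"

definition has_degree :: "((real \<Rightarrow> real) \<Rightarrow> real) \<Rightarrow> nat \<Rightarrow> bool" where
  "has_degree Q m \<longleftrightarrow> (\<forall>j\<le>m. Q (\<phi> j) = I (\<phi> j)) \<and> Q (\<phi> (m + 1)) \<noteq> I (\<phi> (m + 1))"

(* For A and B of degree m the weights cancel the error at the monomial of degree m + 1
   only in the second branch.  In the first branch the value there is mu_A, which differs
   from mu, so there the mean rule is again of degree exactly m. *)
definition mean_rule ::
  "nat \<Rightarrow> ((real \<Rightarrow> real) \<Rightarrow> real) \<Rightarrow> ((real \<Rightarrow> real) \<Rightarrow> real) \<Rightarrow> (real \<Rightarrow> real) \<Rightarrow> real" where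
  "mean_rule m A B g =
     (let \<mu> = I (\<phi> (m + 1)); \<mu>A = A (\<phi> (m + 1)); \<mu>B = B (\<phi> (m + 1)) in
      if \<mu>A = \<mu>B then (A g + B g) / 2
      else (\<mu>B - \<mu>) / (\<mu>B - \<mu>A) * A g + (\<mu> - \<mu>A) / (\<mu>B - \<mu>A) * B g)"

end

theory Submission
  imports Defs
begin

text \<open>The mean rule is an affine combination of A and B: in both branches its weights sum to
  1. Hence it keeps any value on which the two rules agree, in particular the exact integrals of the
  monomials up to degree m (\<open>mean_rule_of_agreement\<close>). When the rules differ at \<phi>
  (m + 1), the weights are those that express the exact moment as an affine combination of the two
  approximate ones, so the errors there cancel (\<open>mean_rule_next_monomial\<close>).\<close>

lemma mean_rule_of_agreement:
  assumes "A g = v" "B g = v"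
  shows "mean_rule m A B g = v"
proof (cases "A (\<phi> (m + 1)) = B (\<phi> (m + 1))")
  case True
  then show ?thesis using assms by (simp add: mean_rule_def)
next
  case False
  define a b u where "a = A (\<phi> (m + 1))" and "b = B (\<phi> (m + 1))" and "u = I (\<phi> (m + 1))"
  have "a \<noteq> b" using False by (simp add: a_def b_def)
  have "mean_rule m A B g = (b - u) / (b - a) * v + (u - a) / (b - a) * v"
    using assms False by (simp add: mean_rule_def Let_def a_def b_def u_def)
  also have "\<dots> = ((b - u) / (b - a) + (u - a) / (b - a)) * v"
    by (rule distrib_right [symmetric])
  \<comment> \<open>The numerators telescope to b - a, whatever u is.\<close>
  also have "(b - u) / (b - a) + (u - a) / (b - a) = 1"
    using \<open>a \<noteq> b\<close> by (simp flip: add_divide_distrib)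
  finally show ?thesis by simp
qed

text \<open>The weights are the linear Lagrange basis for the nodes a, b evaluated at u;
  interpolating the identity function at these nodes returns u itself.\<close>

lemma mean_rule_next_monomial:
  assumes "A (\<phi> (m + 1)) \<noteq> B (\<phi> (m + 1))"
  shows "mean_rule m A B (\<phi> (m + 1)) = I (\<phi> (m + 1))"
proof -
  define a b u where "a = A (\<phi> (m + 1))" and "b = B (\<phi> (m + 1))" and "u = I (\<phi> (m + 1))"
  have "a \<noteq> b" using assms by (simp add: a_def b_def)
  have "mean_rule m A B (\<phi> (m + 1)) = (b - u) / (b - a) * a + (u - a) / (b - a) * b"
    using assms by (simp add: mean_rule_def Let_def a_def b_def u_def)
  also have "\<dots> = ((b - u) * a + (u - a) * b) / (b - a)"
    by (simp add: add_divide_distrib)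
  also have "(b - u) * a + (u - a) * b = u * (b - a)"
    by (simp add: algebra_simps)
  finally show ?thesis using \<open>a \<noteq> b\<close> by (simp add: u_def)
qed

text \<open>The gain of one degree is conditional because rules with equal values at \<phi> (m + 1)
  are merely averaged: W then repeats their common value, which \<open>has_degree\<close> makes
  different from the integral.\<close>

theorem proposition2:
  fixes m :: nat and A B :: "(real \<Rightarrow> real) \<Rightarrow> real"
  assumes "quadrature_rule A" and "quadrature_rule B"
    and "has_degree A m" and "has_degree B m"
  shows "degree_at_least (mean_rule m A B) m \<and>
         (A (\<phi> (m + 1)) \<noteq> B (\<phi> (m + 1)) \<longrightarrow> degree_at_least (mean_rule m A B) (m + 1))"
proof (intro conjI impI)
  have low: "mean_rule m A B (\<phi> j) = I (\<phi> j)" if "j \<le> m" for j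
    using assms(3,4) that by (intro mean_rule_of_agreement) (auto simp: has_degree_def)
  then show "degree_at_least (mean_rule m A B) m"
    by (simp add: degree_at_least_def)
  assume "A (\<phi> (m + 1)) \<noteq> B (\<phi> (m + 1))"
  then show "degree_at_least (mean_rule m A B) (m + 1)"
    \<comment> \<open>\<open>le_Suc_eq\<close> isolates the single new exponent j = m + 1.\<close>
    using low mean_rule_next_monomial by (auto simp: degree_at_least_def le_Suc_eq)
qed

end
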